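(* Let $m\ge 3$ and let $f_1,\dots,f_m:\mathcal X\to\mathbb R$ be regressors for the response $Y$, with $\mathbb E[Y]=0$ and $\mathbb E[f_i(X)]=0$ for all $i$. Put $g(x)=\mathbb E[Y\mid X=x]$, $h_i=f_i-g$ and $g_2=\mathbb E[g(X)^2]$. Assume that the $m$ regressors make pairwise independent errors with respect to the conditional mean $g$, in the sense that $$\mathbb E[h_i(X)h_j(X)]=0\qquad\text{for all } i\neq j .$$ If $g_2$ is known, then given only the data matrix $Z=Z^{(n)}\in\mathbb R^{m\times n}$ one can consistently estimate the vector $\boldsymbol\rho=(\rho_1,\dots,\rho_m)^T$, $\rho_i=\mathbb E[f_i(X)Y]$, at rate $O_P(1/\sqrt n)$. That is, there is an estimator $\hat{\boldsymbol\rho}_n=\hat{\boldsymbol\rho}_n(Z^{(n)},g_2)$, computed from $Z^{(n)}$ and $g_2$ alone (and not otherwise depending on the distribution of $(X,Y)$ or on the regressors), such that $$\big\|\hat{\boldsymbol\rho}_n-\boldsymbol\rho\big\|=O_P(1/\sqrt n)\qquad (n\to\infty).$$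
   Context: $(X,Y)$ is a pair of random variables with $X\in\mathcal X$ (features, in an instance space) and $Y\in\mathbb R$ (response). The first two moments of $Y$ are finite and known, and the covariance matrix of $f_1(X),\dots,f_m(X)$ exists. The regressors $f_1,\dots,f_m:\mathcal X\to\mathbb R$ are fixed, pre-constructed functions. One observes only the predictions $f_i(x_j)$, $1\le i\le m$, $1\le j\le n$, where $x_1,\dots,x_n$ are i.i.d. samples from the marginal distribution of $X$; the responses are not observed. The mean-centered data matrix is $$Z^{(n)}_{ij}=f_i(x_j)-\frac1n\sum_{k=1}^n f_i(x_k).$$ By convention the response and all regressors are mean-centered, i.e. $\mathbb E[f_i(X)]=\mathbb E[Y]=0$. The notation $A_n=O_P(1/\sqrt n)$ means that $\sqrt n\,A_n$ is bounded in probability as $n\to\infty$, with $m$, the distribution of $(X,Y)$ and the $f_i$ fixed.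
   Formalization: It is additionally assumed that E[f_i(X)^2 f_j(X)^2] is finite for all i ≠ j; with only finite second moments, no estimator attains the rate 1/√n for every admissible law. *)

theory Defs
  imports "HOL-Probability.Probability"
begin

text \<open>
  The function \<open>g\<close> is a version of \<open>x \<mapsto> E[Y | X = x]\<close>: it is measurable on the instance
  space, and \<open>g \<circ> X\<close> is a version of the conditional expectation of \<open>Y\<close> given the
  sigma-algebra generated by \<open>X\<close>. Such a \<open>g\<close> is unique up to null sets of the law of \<open>X\<close>.
\<close>
definition is_cond_mean ::
  "'w measure \<Rightarrow> 'x measure \<Rightarrow> ('w \<Rightarrow> 'x) \<Rightarrow> ('w \<Rightarrow> real) \<Rightarrow> ('x \<Rightarrow> real) \<Rightarrow> bool"
where
  "is_cond_mean M MX X Y g \<longleftrightarrow>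
     g \<in> borel_measurable MX \<and>
     (AE \<omega> in M. g (X \<omega>) = real_cond_exp M (vimage_algebra (space M) X MX) Y \<omega>)"

text \<open>
  The samples \<open>xs 0, xs 1, \<dots>\<close> are independent copies of \<open>X\<close>. Nothing is assumed about their
  joint law with \<open>(X, Y)\<close>. The sample of size \<open>n\<close> is \<open>xs 0, \<dots>, xs (n - 1)\<close>.

  The assumption \<open>f_prod_sq\<close> says that the products \<open>f\<^sub>i(X) f\<^sub>j(X)\<close> have finite variance for
  \<open>i \<noteq> j\<close>. Finite second moments of the \<open>f\<^sub>i(X)\<close> alone do not allow the rate \<open>1/\<surd>n\<close>.
\<close>
locale ensemble_regression = prob_space M
  for M :: "'w measure" +
  fixes MX :: "'x measure"
    and X :: "'w \<Rightarrow> 'x"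
    and Y :: "'w \<Rightarrow> real"
    and f :: "'m::finite \<Rightarrow> 'x \<Rightarrow> real"
    and xs :: "nat \<Rightarrow> 'w \<Rightarrow> 'x"
  assumes X_measurable: "X \<in> measurable M MX"
    and Y_measurable: "Y \<in> borel_measurable M"
    and Y_integrable: "integrable M Y"
    and Y_sq_integrable: "integrable M (\<lambda>\<omega>. (Y \<omega>)\<^sup>2)"
    and Y_centered: "expectation Y = 0"
    and f_measurable: "f i \<in> borel_measurable MX"
    and f_integrable: "integrable M (\<lambda>\<omega>. f i (X \<omega>))"
    and f_sq_integrable: "integrable M (\<lambda>\<omega>. (f i (X \<omega>))\<^sup>2)"
    and f_centered: "expectation (\<lambda>\<omega>. f i (X \<omega>)) = 0"
    and f_prod_sq: "i \<noteq> j \<Longrightarrow> integrable M (\<lambda>\<omega>. (f i (X \<omega>) * f j (X \<omega>))\<^sup>2)"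
    and samples_indep: "indep_vars (\<lambda>_. MX) xs UNIV"
    and samples_distr: "distr M MX (xs k) = distr M MX X"

text \<open>
  The \<open>m \<times> n\<close> mean-centered data matrix, stored by columns: the entry in row \<open>i\<close> and column
  \<open>j < n\<close> is \<open>data_matrix f n x j $ i\<close>. Columns with index \<open>j \<ge> n\<close> are \<open>undefined\<close>, so
  the matrix carries no information beyond its \<open>m n\<close> entries and is a point of the product
  space \<open>PiM {..<n} (\<lambda>_. borel)\<close>.
\<close>
definition data_matrix ::
  "('m::finite \<Rightarrow> 'x \<Rightarrow> real) \<Rightarrow> nat \<Rightarrow> (nat \<Rightarrow> 'x) \<Rightarrow> (nat \<Rightarrow> real ^ 'm)"
where
  "data_matrix f n x =
     (\<lambda>j\<in>{..<n}. \<chi> i. f i (x j) - (\<Sum>k<n. f i (x k)) / real n)"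

text \<open>
  Measurability is part of the definition because \<open>measure\<close> is \<open>0\<close> on non-measurable sets.
\<close>
definition bounded_in_probability :: "'w measure \<Rightarrow> (nat \<Rightarrow> 'w \<Rightarrow> real) \<Rightarrow> bool" where
  "bounded_in_probability M B \<longleftrightarrow>
     (\<forall>n. B n \<in> borel_measurable M) \<and>
     (\<forall>\<epsilon>>0. \<exists>K. \<forall>\<^sub>F n in sequentially. measure M {\<omega> \<in> space M. \<bar>B n \<omega>\<bar> > K} \<le> \<epsilon>)"

end

theory Submission
  imports Defs
begin

text \<open>
  Since \<open>\<rho>\<^sub>i = E[f\<^sub>i(X) g(X)]\<close>, uncorrelated errors give
  \<open>c\<^sub>i\<^sub>j = E[f\<^sub>i(X) f\<^sub>j(X)] = \<rho>\<^sub>i + \<rho>\<^sub>j - g\<^sub>2\<close> for \<open>i \<noteq> j\<close>. Hence, for distinct \<open>i\<close>, \<open>p\<close>,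
  \<open>q\<close>, \<open>\<rho>\<^sub>i = (c\<^sub>i\<^sub>p + c\<^sub>i\<^sub>q - c\<^sub>p\<^sub>q + g\<^sub>2) / 2\<close>, and the estimator replaces the covariances by
  sample covariances. Only off-diagonal entries occur, so finite variance of the products
  \<open>f\<^sub>i(X) f\<^sub>j(X)\<close> with \<open>i \<noteq> j\<close> bounds \<open>\<surd>n\<close> times the error in \<open>L\<^sup>1\<close>, and Markov's inequality
  concludes.
\<close>

section \<open>Sequences bounded in L1, and their relation to boundedness in probability\<close>

text \<open>This is the form in which \<open>O_P(1)\<close> is carried through the proof: bounds
  simply add, with no splitting of \<epsilon>. Integrability is required explicitly because the
  integral of a non-integrable function is 0 by convention.\<close>

definition L1_bounded :: "'w measure \<Rightarrow> (nat \<Rightarrow> 'w \<Rightarrow> real) \<Rightarrow> bool" where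
  "L1_bounded M B \<longleftrightarrow> (\<exists>K. \<forall>n. integrable M (B n) \<and> (\<integral>\<omega>. \<bar>B n \<omega>\<bar> \<partial>M) \<le> K)"

lemma L1_bounded_dominated:
  assumes A: "L1_bounded M A"
    and [measurable]: "\<And>n. B n \<in> borel_measurable M"
    and le: "\<And>n \<omega>. \<omega> \<in> space M \<Longrightarrow> \<bar>B n \<omega>\<bar> \<le> \<bar>A n \<omega>\<bar>"
  shows "L1_bounded M B"
proof -
  obtain K where K: "\<And>n. integrable M (A n)" "\<And>n. (\<integral>\<omega>. \<bar>A n \<omega>\<bar> \<partial>M) \<le> K"
    using A unfolding L1_bounded_def by auto
  have int: "integrable M (B n)" for n
    by (rule Bochner_Integration.integrable_bound[OF K(1)[of n]]) (auto intro!: AE_I2 le)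
  have "(\<integral>\<omega>. \<bar>B n \<omega>\<bar> \<partial>M) \<le> (\<integral>\<omega>. \<bar>A n \<omega>\<bar> \<partial>M)" for n
    by (intro integral_mono integrable_abs int K(1) le)
  then show ?thesis
    unfolding L1_bounded_def using int K(2) order_trans by blast
qed

lemma L1_bounded_add:
  assumes "L1_bounded M A" "L1_bounded M B"
  shows "L1_bounded M (\<lambda>n \<omega>. A n \<omega> + B n \<omega>)"
proof -
  obtain K L where K: "\<And>n. integrable M (A n)" "\<And>n. (\<integral>\<omega>. \<bar>A n \<omega>\<bar> \<partial>M) \<le> K"
    and L: "\<And>n. integrable M (B n)" "\<And>n. (\<integral>\<omega>. \<bar>B n \<omega>\<bar> \<partial>M) \<le> L"
    using assms unfolding L1_bounded_def by metis
  have "(\<integral>\<omega>. \<bar>A n \<omega> + B n \<omega>\<bar> \<partial>M) \<le> K + L" for n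
  proof -
    have "(\<integral>\<omega>. \<bar>A n \<omega> + B n \<omega>\<bar> \<partial>M) \<le> (\<integral>\<omega>. \<bar>A n \<omega>\<bar> + \<bar>B n \<omega>\<bar> \<partial>M)"
      by (intro integral_mono integrable_abs Bochner_Integration.integrable_add K(1) L(1)) auto
    also have "\<dots> = (\<integral>\<omega>. \<bar>A n \<omega>\<bar> \<partial>M) + (\<integral>\<omega>. \<bar>B n \<omega>\<bar> \<partial>M)"
      by (intro Bochner_Integration.integral_add integrable_abs K(1) L(1))
    also have "\<dots> \<le> K + L"
      using K(2) L(2) by (rule add_mono)
    finally show ?thesis .
  qed
  then show ?thesis
    unfolding L1_bounded_def using K(1) L(1) by blast
qed

lemma L1_bounded_sum:
  assumes "finite I" "\<And>i. i \<in> I \<Longrightarrow> L1_bounded M (A i)"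
  shows "L1_bounded M (\<lambda>n \<omega>. \<Sum>i\<in>I. A i n \<omega>)"
  using assms
proof (induction I)
  case empty
  show ?case by (auto simp: L1_bounded_def)
next
  case (insert i I)
  then show ?case by (simp add: L1_bounded_add)
qed

lemma L1_bounded_abs:
  "L1_bounded M B \<Longrightarrow> L1_bounded M (\<lambda>n \<omega>. \<bar>B n \<omega>\<bar>)"
  unfolding L1_bounded_def by auto

text \<open>Markov's inequality: the probability of exceeding a level \<open>c\<close> is at most
  the L1 bound divided by \<open>c\<close>, uniformly in \<open>n\<close>.\<close>

lemma (in prob_space) L1_bounded_imp_bounded_in_probability:
  assumes "L1_bounded M B"
  shows "bounded_in_probability M B"
  unfolding bounded_in_probability_def
proof (intro conjI allI impI)
  obtain K where K: "\<And>n. integrable M (B n)" "\<And>n. (\<integral>\<omega>. \<bar>B n \<omega>\<bar> \<partial>M) \<le> K"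
    using assms unfolding L1_bounded_def by auto
  show [measurable]: "B n \<in> borel_measurable M" for n
    using K(1) by auto
  fix \<epsilon> :: real assume "\<epsilon> > 0"
  \<comment> \<open>The summand 1 keeps the threshold positive even when \<open>K\<close> is 0, so
    that division by \<open>c\<close> is legitimate.\<close>
  define c where "c = (\<bar>K\<bar> + 1) / \<epsilon>"
  have c: "c > 0" using \<open>\<epsilon> > 0\<close> by (simp add: c_def)
  have "measure M {\<omega> \<in> space M. \<bar>B n \<omega>\<bar> > c} \<le> \<epsilon>" for n
  proof -
    have "measure M {\<omega> \<in> space M. \<bar>B n \<omega>\<bar> > c} \<le> measure M {\<omega> \<in> space M. \<bar>B n \<omega>\<bar> \<ge> c}"
      by (intro finite_measure_mono) auto
    also have "\<dots> \<le> (\<integral>\<omega>. \<bar>B n \<omega>\<bar> \<partial>M) / c"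
      by (intro integral_Markov_inequality_measure[where A = "{}"] integrable_abs K(1)) (use c in auto)
    also have "\<dots> \<le> (\<bar>K\<bar> + 1) / c"
      using K(2)[of n] c by (intro divide_right_mono) auto
    also have "\<dots> = \<epsilon>" using \<open>\<epsilon> > 0\<close> by (simp add: c_def field_simps)
    finally show ?thesis .
  qed
  then show "\<exists>c. \<forall>\<^sub>F n in sequentially. measure M {\<omega> \<in> space M. \<bar>B n \<omega>\<bar> > c} \<le> \<epsilon>"
    by (intro exI[of _ c] always_eventually allI)
qed

section \<open>Second moments of products and of independent sums\<close>

lemma integrable_mult_of_squares:
  fixes u v :: "'w \<Rightarrow> real"
  assumes [measurable]: "u \<in> borel_measurable M" "v \<in> borel_measurable M"
    and "integrable M (\<lambda>\<omega>. (u \<omega>)\<^sup>2)" "integrable M (\<lambda>\<omega>. (v \<omega>)\<^sup>2)"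
  shows "integrable M (\<lambda>\<omega>. u \<omega> * v \<omega>)"
proof (rule Bochner_Integration.integrable_bound[OF Bochner_Integration.integrable_add[OF assms(3,4)]])
  show "AE \<omega> in M. norm (u \<omega> * v \<omega>) \<le> norm ((u \<omega>)\<^sup>2 + (v \<omega>)\<^sup>2)"
  proof (rule AE_I2)
    fix \<omega>
    have "0 \<le> (\<bar>u \<omega>\<bar> - \<bar>v \<omega>\<bar>)\<^sup>2" by simp
    then have "2 * (\<bar>u \<omega>\<bar> * \<bar>v \<omega>\<bar>) \<le> (u \<omega>)\<^sup>2 + (v \<omega>)\<^sup>2"
      by (simp add: power2_diff)
    moreover have "0 \<le> \<bar>u \<omega>\<bar> * \<bar>v \<omega>\<bar>" by simp
    ultimately have "\<bar>u \<omega>\<bar> * \<bar>v \<omega>\<bar> \<le> (u \<omega>)\<^sup>2 + (v \<omega>)\<^sup>2" by linarith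
    then show "norm (u \<omega> * v \<omega>) \<le> norm ((u \<omega>)\<^sup>2 + (v \<omega>)\<^sup>2)"
      by (simp add: abs_mult)
  qed
qed simp

text \<open>Pythagoras for independent centered variables. In the induction the new summand is
  independent of the partial sum, so the expectation of the cross term factors into a product of
  zeros. Integrability is part of the claim because the induction step needs it for the partial
  sum.\<close>

lemma (in prob_space) indep_vars_sum_second_moment:
  fixes U :: "'i \<Rightarrow> 'a \<Rightarrow> real"
  assumes "finite I" "indep_vars (\<lambda>_. borel) U I"
    and "\<And>i. i \<in> I \<Longrightarrow> integrable M (\<lambda>\<omega>. (U i \<omega>)\<^sup>2)"
    and "\<And>i. i \<in> I \<Longrightarrow> expectation (U i) = 0"
  shows "integrable M (\<lambda>\<omega>. (\<Sum>i\<in>I. U i \<omega>)\<^sup>2) \<and>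
    expectation (\<lambda>\<omega>. (\<Sum>i\<in>I. U i \<omega>)\<^sup>2) = (\<Sum>i\<in>I. expectation (\<lambda>\<omega>. (U i \<omega>)\<^sup>2))"
  using assms
proof (induction I)
  case empty
  then show ?case by simp
next
  case (insert i I)
  let ?S = "\<lambda>\<omega>. \<Sum>i\<in>I. U i \<omega>"
  have meas [measurable]: "U k \<in> borel_measurable M" if "k \<in> insert i I" for k
    using insert.prems(1) that unfolding indep_vars_def2 by auto
  have meas_S [measurable]: "?S \<in> borel_measurable M"
    using meas by (intro borel_measurable_sum) auto
  have IH: "integrable M (\<lambda>\<omega>. (?S \<omega>)\<^sup>2)"
    "expectation (\<lambda>\<omega>. (?S \<omega>)\<^sup>2) = (\<Sum>i\<in>I. expectation (\<lambda>\<omega>. (U i \<omega>)\<^sup>2))"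
    using insert.IH insert.prems indep_vars_subset[OF insert.prems(1), of I] by auto
  have int: "integrable M (U i)" "integrable M ?S"
    using insert.prems(2) IH(1) meas meas_S by (auto intro: square_integrable_imp_integrable)
  have ind: "indep_var borel (U i) borel ?S"
    by (rule indep_vars_sum[OF insert.hyps insert.prems(1)])
  have prod: "integrable M (\<lambda>\<omega>. U i \<omega> * ?S \<omega>)" "expectation (\<lambda>\<omega>. U i \<omega> * ?S \<omega>) = 0"
    using indep_var_integrable[OF ind int] indep_var_lebesgue_integral[OF ind int] insert.prems(3)
    by auto
  have sq: "integrable M (\<lambda>\<omega>. (U i \<omega>)\<^sup>2)" using insert.prems by simp
  have eq: "(\<lambda>\<omega>. (\<Sum>i\<in>insert i I. U i \<omega>)\<^sup>2) =
      (\<lambda>\<omega>. ((U i \<omega>)\<^sup>2 + (?S \<omega>)\<^sup>2) + 2 * (U i \<omega> * ?S \<omega>))"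
    using insert.hyps by (simp add: power2_sum mult.assoc)
  show ?case
    unfolding eq using insert.hyps prod sq IH
    by (auto intro!: Bochner_Integration.integrable_add)
qed

section \<open>Sample covariances as functions of the data matrix\<close>

lemma borel_measurable_vecI:
  fixes u :: "'a \<Rightarrow> real ^ 'n"
  assumes "\<And>i. (\<lambda>x. u x $ i) \<in> borel_measurable N"
  shows "u \<in> borel_measurable N"
  using assms unfolding borel_measurable_euclidean_space[of u]
  by (auto simp: Basis_vec_def inner_axis)

text \<open>No mean is subtracted here, since the columns of the data matrix arrive centered. For
  \<open>n = 0\<close> the value is 0, by the convention for division.\<close>

definition sample_cov :: "nat \<Rightarrow> (nat \<Rightarrow> real ^ 'm) \<Rightarrow> 'm \<Rightarrow> 'm \<Rightarrow> real" where
  "sample_cov n z i j = (\<Sum>k<n. z k $ i * z k $ j) / real n"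

lemma sample_cov_measurable [measurable]:
  "(\<lambda>z. sample_cov n z i j) \<in> borel_measurable (PiM {..<n} (\<lambda>_. borel))"
proof -
  have [measurable]: "(\<lambda>z :: nat \<Rightarrow> real ^ 'b. z k $ l) \<in> borel_measurable (PiM {..<n} (\<lambda>_. borel))"
    if "k < n" for k l
  proof -
    have "(\<lambda>z. z k) \<in> measurable (PiM {..<n} (\<lambda>_. borel)) (borel :: (real ^ 'b) measure)"
      using that by (intro measurable_component_singleton) auto
    then show ?thesis
      by (rule measurable_compose) simp
  qed
  show ?thesis
    unfolding sample_cov_def by measurable
qed

text \<open>The usual identity: mean of the products minus product of the means. It separates a
  sample mean of \<open>f i * f j\<close>, which has error of order \<open>1/sqrt n\<close>, from a
  product of two centered sample means, which is of order \<open>1/n\<close>.\<close>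

lemma sample_cov_data_matrix:
  "sample_cov n (data_matrix f n x) i j =
    (\<Sum>k<n. f i (x k) * f j (x k)) / real n
    - (\<Sum>k<n. f i (x k)) / real n * ((\<Sum>k<n. f j (x k)) / real n)"
proof (cases "n = 0")
  case True
  then show ?thesis by (simp add: sample_cov_def)
next
  case False
  define a where "a = (\<Sum>k<n. f i (x k)) / real n"
  define b where "b = (\<Sum>k<n. f j (x k)) / real n"
  have sums: "(\<Sum>k<n. f i (x k)) = real n * a" "(\<Sum>k<n. f j (x k)) = real n * b"
    using False by (auto simp: a_def b_def)
  have "(\<Sum>k<n. data_matrix f n x k $ i * data_matrix f n x k $ j) =
      (\<Sum>k<n. f i (x k) * f j (x k) - b * f i (x k) - a * f j (x k) + a * b)"
    by (intro sum.cong) (auto simp: data_matrix_def algebra_simps simp flip: a_def b_def)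
  also have "\<dots> = (\<Sum>k<n. f i (x k) * f j (x k)) - b * (\<Sum>k<n. f i (x k))
      - a * (\<Sum>k<n. f j (x k)) + real n * (a * b)"
    by (simp add: sum.distrib sum_subtractf sum_distrib_left)
  also have "\<dots> = (\<Sum>k<n. f i (x k) * f j (x k)) - real n * (a * b)"
    by (simp add: sums)
  finally show ?thesis
    using False unfolding sample_cov_def a_def[symmetric] b_def[symmetric]
    by (simp add: diff_divide_distrib)
qed

section \<open>Rate of convergence of the sample means and covariances\<close>

context ensemble_regression
begin

lemma xs_measurable [measurable]: "xs k \<in> measurable M MX"
  using samples_indep unfolding indep_vars_def2 by auto

declare X_measurable [measurable] Y_measurable [measurable] f_measurable [measurable]

lemma sample_integrable:
  fixes \<phi> :: "'x \<Rightarrow> real"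
  assumes [measurable]: "\<phi> \<in> borel_measurable MX" and "integrable M (\<lambda>\<omega>. \<phi> (X \<omega>))"
  shows "integrable M (\<lambda>\<omega>. \<phi> (xs k \<omega>))"
proof -
  have "integrable (distr M MX X) \<phi>"
    using assms(2) by (subst integrable_distr_eq) auto
  then have "integrable (distr M MX (xs k)) \<phi>"
    by (simp add: samples_distr)
  then show ?thesis
    by (subst (asm) integrable_distr_eq) auto
qed

lemma sample_expectation:
  fixes \<phi> :: "'x \<Rightarrow> real"
  assumes [measurable]: "\<phi> \<in> borel_measurable MX"
  shows "expectation (\<lambda>\<omega>. \<phi> (xs k \<omega>)) = expectation (\<lambda>\<omega>. \<phi> (X \<omega>))"
proof -
  have "expectation (\<lambda>\<omega>. \<phi> (xs k \<omega>)) = (\<integral>x. \<phi> x \<partial>distr M MX (xs k))"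
    by (subst integral_distr) auto
  also have "\<dots> = expectation (\<lambda>\<omega>. \<phi> (X \<omega>))"
    unfolding samples_distr by (subst integral_distr) auto
  finally show ?thesis .
qed

text \<open>The sample mean of i.i.d. variables with variance \<open>V\<close> has mean squared
  error \<open>V / n\<close>, so multiplying by \<open>n\<close> leaves the bound \<open>V\<close>.
  The error is kept squared, so that it can dominate both linear terms and products of two
  means.\<close>

lemma sample_mean_L1_bounded:
  fixes \<phi> :: "'x \<Rightarrow> real"
  assumes [measurable]: "\<phi> \<in> borel_measurable MX"
    and sq: "integrable M (\<lambda>\<omega>. (\<phi> (X \<omega>))\<^sup>2)"
    and \<mu>: "expectation (\<lambda>\<omega>. \<phi> (X \<omega>)) = \<mu>"
  shows "L1_bounded M (\<lambda>n \<omega>. real n * ((\<Sum>k<n. \<phi> (xs k \<omega>)) / real n - \<mu>)\<^sup>2)"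
proof -
  let ?U = "\<lambda>k \<omega>. \<phi> (xs k \<omega>) - \<mu>"
  define V where "V = expectation (\<lambda>\<omega>. (\<phi> (X \<omega>) - \<mu>)\<^sup>2)"
  have int: "integrable M (\<lambda>\<omega>. \<phi> (X \<omega>))"
    by (rule square_integrable_imp_integrable[OF _ sq]) simp
  have "integrable M (\<lambda>\<omega>. (\<phi> (X \<omega>))\<^sup>2 + \<mu>\<^sup>2 - 2 * \<phi> (X \<omega>) * \<mu>)"
    using int sq by (intro Bochner_Integration.integrable_add Bochner_Integration.integrable_diff) auto
  then have int2: "integrable M (\<lambda>\<omega>. (\<phi> (X \<omega>) - \<mu>)\<^sup>2)"
    by (simp add: power2_diff)
  \<comment> \<open>Independence of the \<open>xs k\<close> passes to their images under one fixed
    measurable function.\<close>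
  have indep: "indep_vars (\<lambda>_. borel) ?U {..<n}" for n
    by (rule indep_vars_subset[OF indep_vars_compose2[OF samples_indep, of "\<lambda>_ x. \<phi> x - \<mu>"]]) auto
  have "integrable M (\<lambda>\<omega>. (?U k \<omega>)\<^sup>2)" for k
    using sample_integrable[of "\<lambda>x. (\<phi> x - \<mu>)\<^sup>2"] int2 by simp
  moreover have "expectation (?U k) = 0" for k
    using sample_expectation[of \<phi>] sample_integrable[of \<phi>] int \<mu> by (simp add: prob_space)
  moreover have "expectation (\<lambda>\<omega>. (?U k \<omega>)\<^sup>2) = V" for k
    using sample_expectation[of "\<lambda>x. (\<phi> x - \<mu>)\<^sup>2"] by (simp add: V_def)
  ultimately have S: "integrable M (\<lambda>\<omega>. (\<Sum>k<n. ?U k \<omega>)\<^sup>2)"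
    "expectation (\<lambda>\<omega>. (\<Sum>k<n. ?U k \<omega>)\<^sup>2) = real n * V" for n
    using indep_vars_sum_second_moment[OF _ indep, of n] by auto
  have eq: "real n * ((\<Sum>k<n. \<phi> (xs k \<omega>)) / real n - \<mu>)\<^sup>2 = (\<Sum>k<n. ?U k \<omega>)\<^sup>2 / real n" for n \<omega>
  proof (cases "n = 0")
    case False
    then have "(\<Sum>k<n. \<phi> (xs k \<omega>)) / real n - \<mu> = (\<Sum>k<n. ?U k \<omega>) / real n"
      by (simp add: sum_subtractf field_simps)
    then show ?thesis
      using False by (simp add: power_divide power2_eq_square)
  qed simp
  have V: "V \<ge> 0" unfolding V_def by simp
  show ?thesis
    unfolding L1_bounded_def eq
  proof (intro exI[of _ V] allI conjI)
    fix n
    show "integrable M (\<lambda>\<omega>. (\<Sum>k<n. ?U k \<omega>)\<^sup>2 / real n)"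
      using S(1) by simp
    have "(\<integral>\<omega>. \<bar>(\<Sum>k<n. ?U k \<omega>)\<^sup>2 / real n\<bar> \<partial>M) = real n * V / real n"
      by (simp add: S(2))
    also have "\<dots> \<le> V" using V by (cases "n = 0") auto
    finally show "(\<integral>\<omega>. \<bar>(\<Sum>k<n. ?U k \<omega>)\<^sup>2 / real n\<bar> \<partial>M) \<le> V" .
  qed
qed

text \<open>With \<open>p\<close> the error of the mean of products and \<open>a\<close>,
  \<open>b\<close> the two sample means, the covariance error is \<open>p - a * b\<close>. After
  scaling by \<open>sqrt n\<close>, the first part is at most \<open>1 + n * p^2\<close> and the
  second at most \<open>n * (a^2 + b^2)\<close>, and all these squares are controlled by
  \<open>sample_mean_L1_bounded\<close>. The condition \<open>i \<noteq> j\<close> gives access to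
  \<open>f_prod_sq\<close>.\<close>

lemma sample_cov_L1_bounded:
  assumes "i \<noteq> j"
  shows "L1_bounded M (\<lambda>n \<omega>. sqrt (real n) *
    (sample_cov n (data_matrix f n (\<lambda>k. xs k \<omega>)) i j - expectation (\<lambda>\<omega>. f i (X \<omega>) * f j (X \<omega>))))"
proof -
  define c where "c = expectation (\<lambda>\<omega>. f i (X \<omega>) * f j (X \<omega>))"
  let ?P = "\<lambda>n \<omega>. (\<Sum>k<n. f i (xs k \<omega>) * f j (xs k \<omega>)) / real n - c"
  let ?m = "\<lambda>i n \<omega>. (\<Sum>k<n. f i (xs k \<omega>)) / real n"
  have P: "L1_bounded M (\<lambda>n \<omega>. real n * (?P n \<omega>)\<^sup>2)"
    using sample_mean_L1_bounded[of "\<lambda>x. f i x * f j x" c] f_prod_sq[OF assms]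
    by (simp add: c_def)
  have m: "L1_bounded M (\<lambda>n \<omega>. real n * (?m i n \<omega>)\<^sup>2)" for i
    using sample_mean_L1_bounded[of "f i" 0] f_sq_integrable f_centered by simp
  have one: "L1_bounded M (\<lambda>n \<omega>. 1)"
    unfolding L1_bounded_def by (auto simp: prob_space)
  have "L1_bounded M (\<lambda>n \<omega>. sqrt (real n) *
      (sample_cov n (data_matrix f n (\<lambda>k. xs k \<omega>)) i j - c))"
  proof (rule L1_bounded_dominated[OF L1_bounded_add[OF L1_bounded_add[OF one P]
        L1_bounded_add[OF m[of i] m[of j]]]])
    show "(\<lambda>\<omega>. sqrt (real n) * (sample_cov n (data_matrix f n (\<lambda>k. xs k \<omega>)) i j - c))
        \<in> borel_measurable M" for n
      unfolding sample_cov_data_matrix by measurable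
  next
    fix n \<omega>
    define s where "s = sqrt (real n)"
    define p where "p = ?P n \<omega>"
    define a where "a = ?m i n \<omega>"
    define b where "b = ?m j n \<omega>"
    \<comment> \<open>The bound \<open>s \<le> s^2\<close> fails strictly between 0 and 1, but the
      square root of a natural number is 0 or at least 1.\<close>
    have s: "0 \<le> s" "s \<le> s\<^sup>2" "s\<^sup>2 = real n"
    proof -
      show "s \<le> s\<^sup>2"
        using self_le_power[of s 2] by (cases "n = 0") (auto simp: s_def)
    qed (auto simp: s_def)
    have lin: "\<bar>x\<bar> \<le> 1 + x\<^sup>2" for x :: real
      using zero_le_power2[of "\<bar>x\<bar> - 1"] by (simp add: power2_diff)
    have "\<bar>s * p\<bar> \<le> 1 + s\<^sup>2 * p\<^sup>2"
      using lin[of "s * p"] by (simp add: power_mult_distrib)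
    moreover have "\<bar>s * (a * b)\<bar> \<le> s\<^sup>2 * (a\<^sup>2 + b\<^sup>2)"
    proof -
      have "2 * \<bar>a * b\<bar> \<le> a\<^sup>2 + b\<^sup>2"
        using zero_le_power2[of "\<bar>a\<bar> - \<bar>b\<bar>"] by (simp add: power2_diff abs_mult)
      then have "\<bar>a * b\<bar> \<le> a\<^sup>2 + b\<^sup>2" using abs_ge_zero[of "a * b"] by linarith
      then show ?thesis
        using s(1,2) by (simp add: abs_mult[of s] mult_mono)
    qed
    moreover have "\<bar>s * (p - a * b)\<bar> \<le> \<bar>s * p\<bar> + \<bar>s * (a * b)\<bar>"
      by (simp add: right_diff_distrib)
    ultimately have "\<bar>s * (p - a * b)\<bar> \<le> 1 + s\<^sup>2 * p\<^sup>2 + (s\<^sup>2 * a\<^sup>2 + s\<^sup>2 * b\<^sup>2)"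
      by (simp add: distrib_left)
    also have "\<dots> \<le> \<bar>1 + s\<^sup>2 * p\<^sup>2 + (s\<^sup>2 * a\<^sup>2 + s\<^sup>2 * b\<^sup>2)\<bar>" by simp
    finally show "\<bar>sqrt (real n) * (sample_cov n (data_matrix f n (\<lambda>k. xs k \<omega>)) i j - c)\<bar>
      \<le> \<bar>1 + real n * (?P n \<omega>)\<^sup>2 + (real n * (?m i n \<omega>)\<^sup>2 + real n * (?m j n \<omega>)\<^sup>2)\<bar>"
      unfolding sample_cov_data_matrix s(3) p_def a_def b_def
      by (simp add: s_def algebra_simps)
  qed
  then show ?thesis by (simp add: c_def)
qed

section \<open>The conditional mean and the covariance identity\<close>

text \<open>Square integrability is conditional Jensen for the square function. The second claim is
  the defining property of conditional expectation, with the factor \<open>f i (X \<omega>)\<close>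
  measurable with respect to the sigma-algebra generated by \<open>X\<close>.\<close>

lemma cond_mean_moments:
  assumes g: "is_cond_mean M MX X Y g"
  shows "integrable M (\<lambda>\<omega>. (g (X \<omega>))\<^sup>2)"
    and "expectation (\<lambda>\<omega>. f i (X \<omega>) * g (X \<omega>)) = expectation (\<lambda>\<omega>. f i (X \<omega>) * Y \<omega>)"
proof -
  define F where "F = vimage_algebra (space M) X MX"
  have [measurable]: "g \<in> borel_measurable MX"
    and ae: "AE \<omega> in M. g (X \<omega>) = real_cond_exp M F Y \<omega>"
    using g by (auto simp: is_cond_mean_def F_def)
  have XF: "X \<in> measurable F MX"
    unfolding F_def using X_measurable by (intro measurable_vimage_algebra1) (auto intro: measurable_space)
  \<comment> \<open>Measurability of \<open>X\<close> makes \<open>F\<close> a subalgebra of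
    \<open>M\<close>, which gives access to the theory of \<open>real_cond_exp\<close>.\<close>
  have "sets F \<subseteq> sets M"
    unfolding F_def by (auto simp: sets_vimage_algebra2[OF measurable_space[OF X_measurable, THEN Pi_I]])
  then interpret finite_measure_subalgebra M F
    by unfold_locales (auto simp: subalgebra_def F_def)
  have "integrable M (\<lambda>\<omega>. (real_cond_exp M F Y \<omega>)\<^sup>2)"
    using integrable_convex_cond_exp[OF Y_integrable, where I = UNIV and q = power2] Y_sq_integrable convex_power2
    by auto
  moreover have "AE \<omega> in M. (real_cond_exp M F Y \<omega>)\<^sup>2 = (g (X \<omega>))\<^sup>2"
    using ae by eventually_elim simp
  ultimately show "integrable M (\<lambda>\<omega>. (g (X \<omega>))\<^sup>2)"
    by (subst integrable_cong_AE[where g = "\<lambda>\<omega>. (real_cond_exp M F Y \<omega>)\<^sup>2"]) auto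
  have fF: "(\<lambda>\<omega>. f i (X \<omega>)) \<in> borel_measurable F"
    using XF f_measurable by (rule measurable_compose)
  have "expectation (\<lambda>\<omega>. f i (X \<omega>) * g (X \<omega>)) = expectation (\<lambda>\<omega>. f i (X \<omega>) * real_cond_exp M F Y \<omega>)"
    using ae by (intro integral_cong_AE) auto
  also have "\<dots> = expectation (\<lambda>\<omega>. f i (X \<omega>) * Y \<omega>)"
    by (intro real_cond_exp_intg fF integrable_mult_of_squares f_sq_integrable Y_sq_integrable) auto
  finally show "expectation (\<lambda>\<omega>. f i (X \<omega>) * g (X \<omega>)) = expectation (\<lambda>\<omega>. f i (X \<omega>) * Y \<omega>)" .
qed

text \<open>Expand the product of the two errors, then replace the mixed moments with
  \<open>g\<close> by moments with \<open>Y\<close>.\<close>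

lemma covariance_decomposition:
  assumes g: "is_cond_mean M MX X Y g"
    and uncorr: "expectation (\<lambda>\<omega>. (f i (X \<omega>) - g (X \<omega>)) * (f j (X \<omega>) - g (X \<omega>))) = 0"
  shows "expectation (\<lambda>\<omega>. f i (X \<omega>) * f j (X \<omega>)) =
    expectation (\<lambda>\<omega>. f i (X \<omega>) * Y \<omega>) + expectation (\<lambda>\<omega>. f j (X \<omega>) * Y \<omega>)
    - expectation (\<lambda>\<omega>. (g (X \<omega>))\<^sup>2)"
proof -
  have [measurable]: "g \<in> borel_measurable MX" using g by (simp add: is_cond_mean_def)
  note g2 = cond_mean_moments(1)[OF g]
  have fg: "integrable M (\<lambda>\<omega>. f i (X \<omega>) * g (X \<omega>))" for i
    by (intro integrable_mult_of_squares f_sq_integrable g2) auto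
  have ff: "integrable M (\<lambda>\<omega>. f i (X \<omega>) * f j (X \<omega>))"
    by (intro integrable_mult_of_squares f_sq_integrable) auto
  have "(\<lambda>\<omega>. (f i (X \<omega>) - g (X \<omega>)) * (f j (X \<omega>) - g (X \<omega>))) =
      (\<lambda>\<omega>. f i (X \<omega>) * f j (X \<omega>) - f i (X \<omega>) * g (X \<omega>) - f j (X \<omega>) * g (X \<omega>) + (g (X \<omega>))\<^sup>2)"
    by (simp add: algebra_simps power2_eq_square)
  with uncorr have "0 = expectation (\<lambda>\<omega>. f i (X \<omega>) * f j (X \<omega>)) - expectation (\<lambda>\<omega>. f i (X \<omega>) * g (X \<omega>))
      - expectation (\<lambda>\<omega>. f j (X \<omega>) * g (X \<omega>)) + expectation (\<lambda>\<omega>. (g (X \<omega>))\<^sup>2)"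
    using fg ff g2 by simp
  then show ?thesis
    unfolding cond_mean_moments(2)[OF g] by linarith
qed

end

theorem theorem1:
  assumes "CARD('m::finite) \<ge> 3"
  shows "\<exists>est :: nat \<Rightarrow> (nat \<Rightarrow> real ^ 'm) \<Rightarrow> real \<Rightarrow> real ^ 'm.
    (\<forall>n c. (\<lambda>z. est n z c) \<in> borel_measurable (PiM {..<n} (\<lambda>_. borel))) \<and>
    (\<forall>(M :: 'w measure) (MX :: 'x measure) X Y (f :: 'm \<Rightarrow> 'x \<Rightarrow> real) xs g g2.
       ensemble_regression M MX X Y f xs \<longrightarrow>
       is_cond_mean M MX X Y g \<longrightarrow>
       g2 = (\<integral>\<omega>. (g (X \<omega>))\<^sup>2 \<partial>M) \<longrightarrow>
       (\<forall>i j. i \<noteq> j \<longrightarrow>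
          (\<integral>\<omega>. (f i (X \<omega>) - g (X \<omega>)) * (f j (X \<omega>) - g (X \<omega>)) \<partial>M) = 0) \<longrightarrow>
       bounded_in_probability M
         (\<lambda>n \<omega>. sqrt (real n) *
            norm (est n (data_matrix f n (\<lambda>j. xs j \<omega>)) g2
                  - (\<chi> i. \<integral>\<omega>. f i (X \<omega>) * Y \<omega> \<partial>M))))"
proof -
  \<comment> \<open>This is where at least three regressors are used: every index must lie in a
    triangle of distinct indices.\<close>
  have "\<exists>p q. p \<noteq> i \<and> q \<noteq> i \<and> p \<noteq> q" for i :: 'm
  proof -
    have "card (UNIV - {i}) \<ge> 2" using assms by (simp add: card_Diff_singleton)
    then obtain S where S: "S \<subseteq> UNIV - {i}" "card S = 2"
      by (metis obtain_subset_with_card_n)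
    then show ?thesis by (auto simp: card_2_iff)
  qed
  \<comment> \<open>The choice of \<open>p\<close> and \<open>q\<close> depends on the index type
    alone. It is made before any distribution or regressors are introduced, so \<open>est\<close> is
    one universal estimator.\<close>
  then obtain p q :: "'m \<Rightarrow> 'm" where pq: "\<And>i. p i \<noteq> i" "\<And>i. q i \<noteq> i" "\<And>i. p i \<noteq> q i"
    by metis
  define est :: "nat \<Rightarrow> (nat \<Rightarrow> real ^ 'm) \<Rightarrow> real \<Rightarrow> real ^ 'm" where
    "est n z c = (\<chi> i. (sample_cov n z i (p i) + sample_cov n z i (q i)
        - sample_cov n z (p i) (q i) + c) / 2)" for n z c
  have est_measurable [measurable]: "(\<lambda>z. est n z c) \<in> borel_measurable (PiM {..<n} (\<lambda>_. borel))"
    for n c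
    unfolding est_def by (rule borel_measurable_vecI) simp
  show ?thesis
  proof (intro exI[of _ est] conjI allI impI)
    show "(\<lambda>z. est n z c) \<in> borel_measurable (PiM {..<n} (\<lambda>_. borel))" for n c
      by (rule est_measurable)
  next
    fix M :: "'w measure" and MX :: "'x measure" and X Y and f :: "'m \<Rightarrow> 'x \<Rightarrow> real" and xs g g2
    assume "ensemble_regression M MX X Y f xs" and g: "is_cond_mean M MX X Y g"
      and g2: "g2 = (\<integral>\<omega>. (g (X \<omega>))\<^sup>2 \<partial>M)"
      and uncorr: "\<forall>i j. i \<noteq> j \<longrightarrow>
          (\<integral>\<omega>. (f i (X \<omega>) - g (X \<omega>)) * (f j (X \<omega>) - g (X \<omega>)) \<partial>M) = 0"
    interpret ensemble_regression M MX X Y f xs by fact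
    define \<rho> where "\<rho> = (\<chi> i. \<integral>\<omega>. f i (X \<omega>) * Y \<omega> \<partial>M)"
    define c where "c i j = expectation (\<lambda>\<omega>. f i (X \<omega>) * f j (X \<omega>))" for i j
    let ?Z = "\<lambda>n \<omega>. data_matrix f n (\<lambda>j. xs j \<omega>)"
    let ?D = "\<lambda>i j n \<omega>. sqrt (real n) * (sample_cov n (?Z n \<omega>) i j - c i j)"
    have D: "L1_bounded M (?D i j)" if "i \<noteq> j" for i j
      unfolding c_def using that by (rule sample_cov_L1_bounded)
    have c: "c i j = \<rho> $ i + \<rho> $ j - g2" if "i \<noteq> j" for i j
      using covariance_decomposition[OF g] uncorr that by (simp add: c_def \<rho>_def g2)
    \<comment> \<open>In \<open>c i (p i) + c i (q i) - c (p i) (q i)\<close> the entries of \<rho>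
      at \<open>p i\<close> and \<open>q i\<close> cancel, leaving
      \<open>2 * \<rho> $ i - g2\<close>.\<close>
    have \<rho>: "\<rho> $ i = (c i (p i) + c i (q i) - c (p i) (q i) + g2) / 2" for i
      using c[OF pq(1)[symmetric], of i] c[OF pq(2)[symmetric], of i] c[OF pq(3), of i] by simp
    have half: "\<bar>(u + v - w) / 2\<bar> \<le> \<bar>u\<bar> + \<bar>v\<bar> + \<bar>w\<bar>" for u v w :: real
      by (intro order_trans[OF _ order_trans[OF abs_triangle_ineq4[of "u + v" w]
            add_right_mono[OF abs_triangle_ineq]]]) simp
    \<comment> \<open>The dominating sequence collects the three covariance errors for each of the
      finitely many coordinates.\<close>
    let ?A = "\<lambda>n \<omega>. \<Sum>i\<in>UNIV. \<bar>?D i (p i) n \<omega>\<bar> + \<bar>?D i (q i) n \<omega>\<bar> + \<bar>?D (p i) (q i) n \<omega>\<bar>"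
    have A: "L1_bounded M ?A"
      by (intro L1_bounded_sum L1_bounded_add L1_bounded_abs D pq(1)[symmetric] pq(2)[symmetric] pq(3)) auto
    have "L1_bounded M (\<lambda>n \<omega>. sqrt (real n) * norm (est n (?Z n \<omega>) g2 - \<rho>))"
    proof (rule L1_bounded_dominated[OF A])
      \<comment> \<open>The random matrix is measurable into the product space on which
        \<open>est\<close> is measurable, so the composition is a random variable.\<close>
      have [measurable]: "?Z n \<in> measurable M (PiM {..<n} (\<lambda>_. borel))" for n
        unfolding data_matrix_def
        by (intro measurable_restrict borel_measurable_vecI) simp
      show "(\<lambda>\<omega>. sqrt (real n) * norm (est n (?Z n \<omega>) g2 - \<rho>)) \<in> borel_measurable M" for n
        by measurable
    next
      fix n \<omega>
      have "sqrt (real n) * norm (est n (?Z n \<omega>) g2 - \<rho>)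
          \<le> sqrt (real n) * (\<Sum>i\<in>UNIV. \<bar>(est n (?Z n \<omega>) g2 - \<rho>) $ i\<bar>)"
        by (intro mult_left_mono norm_le_l1_cart) simp
      also have "\<dots> = (\<Sum>i\<in>UNIV. \<bar>sqrt (real n) * (est n (?Z n \<omega>) g2 - \<rho>) $ i\<bar>)"
        by (simp add: sum_distrib_left abs_mult)
      also have "\<dots> \<le> ?A n \<omega>"
      proof (rule sum_mono)
        fix i
        \<comment> \<open>The estimator and the formula for \<rho> share the same term
          \<open>g2\<close>, so it drops out and only covariance errors remain.\<close>
        have "sqrt (real n) * (est n (?Z n \<omega>) g2 - \<rho>) $ i =
            (?D i (p i) n \<omega> + ?D i (q i) n \<omega> - ?D (p i) (q i) n \<omega>) / 2"
          unfolding est_def by (simp add: \<rho>) (simp add: field_simps)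
        then show "\<bar>sqrt (real n) * (est n (?Z n \<omega>) g2 - \<rho>) $ i\<bar> \<le>
            \<bar>?D i (p i) n \<omega>\<bar> + \<bar>?D i (q i) n \<omega>\<bar> + \<bar>?D (p i) (q i) n \<omega>\<bar>"
          by (simp only: half)
      qed
      finally show "\<bar>sqrt (real n) * norm (est n (?Z n \<omega>) g2 - \<rho>)\<bar> \<le> \<bar>?A n \<omega>\<bar>"
        by simp
    qed
    then show "bounded_in_probability M (\<lambda>n \<omega>. sqrt (real n) *
        norm (est n (?Z n \<omega>) g2 - (\<chi> i. \<integral>\<omega>. f i (X \<omega>) * Y \<omega> \<partial>M)))"
      unfolding \<rho>_def by (rule L1_bounded_imp_bounded_in_probability)
  qed
qed

end
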